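(* Let $8\le m\le n$ and let $c$ be an exact $(m+n+1)$-coloring of $[m]\times[n]$. Then $[m]\times[n]$ contains a rainbow solution to $x_1+x_2=x_3$.
   Context: $[m]\times[n]=\{(i,j)\in\mathbb{Z}^2:1\le i\le m,1\le j\le n\}$ with componentwise addition. An $r$-coloring is a map $c:[m]\times[n]\to\{1,\dots,r\}$, exact if surjective. A rainbow solution to $x_1+x_2=x_3$ is a triple $\alpha,\beta,\gamma\in[m]\times[n]$ with $\alpha+\beta=\gamma$ whose colors are pairwise distinct. *)

theory Defs
  imports Main "HOL-Library.FuncSet" "HOL-Library.Product_Plus"
begin

definition grid :: "nat \<Rightarrow> nat \<Rightarrow> (int \<times> int) set" where
  "grid m n = {1..int m} \<times> {1..int n}"

(* Colorings are total functions; only their values on the colored set S matter. *)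
definition coloring :: "nat \<Rightarrow> 'a set \<Rightarrow> ('a \<Rightarrow> nat) \<Rightarrow> bool" where
  "coloring r S c \<longleftrightarrow> c \<in> S \<rightarrow> {1..r}"

definition exact_coloring :: "nat \<Rightarrow> 'a set \<Rightarrow> ('a \<Rightarrow> nat) \<Rightarrow> bool" where
  "exact_coloring r S c \<longleftrightarrow> coloring r S c \<and> c ` S = {1..r}"

(* On int \<times> int, the addition is the componentwise one of Product_Plus. *)
definition rainbow_solution ::
    "'a::plus set \<Rightarrow> ('a \<Rightarrow> nat) \<Rightarrow> 'a \<Rightarrow> 'a \<Rightarrow> 'a \<Rightarrow> bool" where
  "rainbow_solution S c x1 x2 x3 \<longleftrightarrow>
     x1 \<in> S \<and> x2 \<in> S \<and> x3 \<in> S \<and> x1 + x2 = x3 \<and>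
     c x1 \<noteq> c x2 \<and> c x1 \<noteq> c x3 \<and> c x2 \<noteq> c x3"

end

theory Submission
  imports Defs
begin

text \<open>Suppose there is no rainbow solution. The difference of two points on a line parallel to the
  main diagonal lies on the main diagonal, so each of the m + n - 2 other diagonals carries at most
  one color that is absent from the main one. If the main diagonal has k colors, then k is at
  least 3 and all but at most 2 (k - 3) of the other diagonals carry a color found on no other
  diagonal. Points with such colors form a nearly complete monotone staircase from (m, 1) to
  (1, n). First occurrences of colors on the main diagonal at least double in position; let b be
  the second and h the last. The staircase cannot pass strictly below (h, h), so it has a unit
  step across height b on one side of the main diagonal and a unit step across abscissa b on the
  other. The first step forces (b, b - 1) to have the color of (b, b), the second one forces it to
  have the color of (b - 1, b - 1), and these colors differ.\<close>

section \<open>Doubling sets and unit descents of integers\<close>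

text \<open>Removing the minimum leaves a set whose minimum is at least twice as large; induct on
  the cardinality.\<close>

lemma Max_ge_power_Min:
  fixes P :: "int set"
  assumes "finite P" "card P = Suc j"
    and "\<And>a. a \<in> P \<Longrightarrow> 0 < a"
    and "\<And>a a'. a \<in> P \<Longrightarrow> a' \<in> P \<Longrightarrow> a < a' \<Longrightarrow> 2 * a \<le> a'"
  shows "2 ^ j * Min P \<le> Max P"
  using assms
proof (induction j arbitrary: P)
  case 0
  then obtain a where "P = {a}" by (metis One_nat_def card_1_singletonE)
  then show ?case by simp
next
  case (Suc j)
  have ne: "P \<noteq> {}" using Suc.prems(2) by auto
  define Q where "Q = P - {Min P}"
  have minP: "Min P \<in> P" using ne Suc.prems(1) by simp
  have cQ: "card Q = Suc j" using Suc.prems(1,2) minP by (simp add: Q_def)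
  have fQ: "finite Q" using Suc.prems(1) by (simp add: Q_def)
  have neQ: "Q \<noteq> {}" using cQ by auto
  have minQ: "Min Q \<in> Q" using fQ neQ by simp
  have "2 ^ j * Min Q \<le> Max Q"
    by (rule Suc.IH[OF fQ cQ]) (use Suc.prems(3,4) in \<open>auto simp: Q_def\<close>)
  moreover have "Max Q \<le> Max P"
    using neQ Suc.prems(1) by (intro Max_mono) (auto simp: Q_def)
  moreover have "2 * Min P \<le> Min Q"
  proof (rule Suc.prems(4)[OF minP])
    show "Min Q \<in> P" using minQ by (auto simp: Q_def)
    have "Min P \<le> Min Q" using minQ Suc.prems(1) by (auto simp: Q_def)
    moreover have "Min Q \<noteq> Min P" using minQ by (auto simp: Q_def)
    ultimately show "Min P < Min Q" by simp
  qed
  then have "(2::int) ^ j * (2 * Min P) \<le> 2 ^ j * Min Q" by (intro mult_left_mono) auto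
  moreover have "(2::int) ^ Suc j * Min P = 2 ^ j * (2 * Min P)" by simp
  ultimately show ?case by linarith
qed

text \<open>A budget argument: without such a step, each index missing from \<open>G\<close> pays
  for a drop of at most 2, too little to bring \<open>y\<close> from \<open>y d0\<close> down to
  what \<open>top\<close> demands at the end.\<close>

lemma exists_unit_descent:
  fixes y :: "int \<Rightarrow> int" and G :: "int set"
  assumes d0: "d0 \<in> G" "d0 \<le> L" and b: "1 \<le> b"
    and slope: "\<And>d e. d \<in> G \<Longrightarrow> e \<in> G \<Longrightarrow> d0 \<le> d \<Longrightarrow> d < e \<Longrightarrow> e \<le> L \<Longrightarrow> y d - (e - d) \<le> y e"
    and top: "\<And>d. d \<in> G \<Longrightarrow> d0 \<le> d \<Longrightarrow> d \<le> L \<Longrightarrow> y d \<le> L + 1 - d"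
    and start: "b + 2 * int (card ({d0..L} - G)) < y d0"
  shows "\<exists>d. d0 \<le> d \<and> d < L \<and> d \<in> G \<and> d + 1 \<in> G \<and> b < y d \<and> y (d + 1) = y d - 1"
proof (rule ccontr)
  assume no: "\<not> ?thesis"
  have split: "card ({d0..d} - G) = card ({d0..e} - G) + nat (d - 1 - e)"
    if "d0 \<le> e" "e < d" "d \<in> G" "{e<..<d} \<inter> G = {}" for d e
  proof -
    have "{d0..d} - G = ({d0..e} - G) \<union> {e<..<d}"
    proof (intro equalityI subsetI)
      fix i assume "i \<in> {d0..d} - G"
      then show "i \<in> ({d0..e} - G) \<union> {e<..<d}" using that(3) by (cases "i = d") auto
    next
      fix i assume "i \<in> ({d0..e} - G) \<union> {e<..<d}"
      then show "i \<in> {d0..d} - G" using that by auto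
    qed
    moreover have "card (({d0..e} - G) \<union> {e<..<d}) = card ({d0..e} - G) + card {e<..<d}"
      by (intro card_Un_disjoint) auto
    ultimately show ?thesis by simp
  qed
  \<comment> \<open>Between neighbours in \<open>G\<close> there is no drop, since a drop is at most
    1 and a drop of exactly 1 is excluded. A gap of g >= 1 missing indices allows a drop of at most
    g + 1 <= 2 g.\<close>
  have lower: "d \<in> G \<Longrightarrow> d0 \<le> d \<Longrightarrow> d \<le> L \<Longrightarrow> y d0 \<le> y d + 2 * int (card ({d0..d} - G))" for d
  proof (induction "nat (d - d0)" arbitrary: d rule: less_induct)
    case less
    show ?case
    proof (cases "d = d0")
      case False
      define e where "e = Max (G \<inter> {d0..<d})"
      have "e \<in> G \<inter> {d0..<d}"
        unfolding e_def using d0 less.prems False by (intro Max_in) auto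
      then have e: "e \<in> G" "d0 \<le> e" "e < d" by auto
      have gap: "{e<..<d} \<inter> G = {}"
      proof (rule ccontr)
        assume "{e<..<d} \<inter> G \<noteq> {}"
        then obtain i where i: "i \<in> G" "e < i" "i < d" by auto
        have "i \<le> e" unfolding e_def using i e by (intro Max_ge) auto
        then show False using i by simp
      qed
      have IH: "y d0 \<le> y e + 2 * int (card ({d0..e} - G))"
        using less.hyps[of e] e less.prems by auto
      have "card ({d0..e} - G) \<le> card ({d0..L} - G)"
        using e less.prems by (intro card_mono) auto
      \<comment> \<open>\<open>no\<close> excludes unit drops only above \<open>b\<close>; the
        budget in \<open>start\<close> keeps \<open>y\<close> there.\<close>
      then have "b < y e" using IH start by linarith
      have s: "y e - (d - e) \<le> y d" using slope e less.prems by blast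
      show ?thesis
      proof (cases "d = e + 1")
        case True
        then have "y (e + 1) \<noteq> y e - 1" using no e less.prems \<open>b < y e\<close> by auto
        then show ?thesis using s True IH split[OF e(2,3) less.prems(1) gap] by auto
      next
        case False
        then show ?thesis using s e IH split[OF e(2,3) less.prems(1) gap] by auto
      qed
    qed simp
  qed
  \<comment> \<open>After the last element \<open>e\<close> of \<open>G\<close> all L - e indices
    are missing, while \<open>top\<close> gives y e <= 1 + (L - e). As 1 <= b, this contradicts
    \<open>start\<close>.\<close>
  define e where "e = Max (G \<inter> {d0..L})"
  have "e \<in> G \<inter> {d0..L}" unfolding e_def using d0 by (intro Max_in) auto
  then have e: "e \<in> G" "d0 \<le> e" "e \<le> L" by auto
  have gap: "{e<..L} \<inter> G = {}"
  proof (rule ccontr)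
    assume "{e<..L} \<inter> G \<noteq> {}"
    then obtain i where i: "i \<in> G" "e < i" "i \<le> L" by auto
    have "i \<le> e" unfolding e_def using i e by (intro Max_ge) auto
    then show False using i by simp
  qed
  have "({d0..e} - G) \<union> {e<..L} \<subseteq> {d0..L} - G" using gap e by auto
  then have "card (({d0..e} - G) \<union> {e<..L}) \<le> card ({d0..L} - G)" by (intro card_mono) auto
  moreover have "card (({d0..e} - G) \<union> {e<..L}) = card ({d0..e} - G) + card {e<..L}"
    by (intro card_Un_disjoint) auto
  ultimately have "int (card ({d0..e} - G)) + (L - e) \<le> int (card ({d0..L} - G))" using e by simp
  then show False using lower[OF e] top[OF e] start b e by linarith
qed

lemma four_mult_le_power: "4 * k + 4 \<le> 2 ^ (k + 2)" for k :: nat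
  by (induction k) auto

section \<open>Diagonals and colors confined to one of them\<close>

definition diag :: "int \<times> int \<Rightarrow> int" where
  "diag p = fst p - snd p"

locale rainbow_free =
  fixes m n :: nat and c :: "int \<times> int \<Rightarrow> nat"
  assumes pos: "1 \<le> m" and le: "m \<le> n"
    and free: "\<not> rainbow_solution (grid m n) c \<alpha> \<beta> \<gamma>"
begin

abbreviation S :: "(int \<times> int) set" where "S \<equiv> grid m n"

definition old :: "nat set" where
  "old = (\<lambda>a. c (a, a)) ` {1..int m}"

text \<open>The color of such a point differs from that of every grid point on another diagonal.
  Nearly all color inequalities below come from this.\<close>

definition lone :: "int \<times> int \<Rightarrow> bool" where
  "lone p \<longleftrightarrow> p \<in> S \<and> diag p \<noteq> 0 \<and> (\<forall>q\<in>S. c q = c p \<longrightarrow> diag q = diag p)"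

definition good :: "int \<Rightarrow> bool" where
  "good d \<longleftrightarrow> (\<exists>p. lone p \<and> diag p = d)"

definition bad :: "int set" where
  "bad = {d \<in> {1 - int n..int m - 1} - {0}. \<not> good d}"

lemma in_S [simp]: "(a, b) \<in> S \<longleftrightarrow> 1 \<le> a \<and> a \<le> int m \<and> 1 \<le> b \<and> b \<le> int n"
  by (auto simp: grid_def)

lemma diag_Pair [simp]: "diag (a, b) = a - b"
  by (simp add: diag_def)

lemma finite_S: "finite S"
  by (simp add: grid_def)

lemma finite_bad: "finite bad"
  by (rule finite_subset[of _ "{1 - int n..int m - 1}"]) (auto simp: bad_def)

lemma diag_in_S: "a \<in> {1..int m} \<Longrightarrow> (a, a) \<in> S"
  using le by simp

lemma not_rainbow:
  assumes "u \<in> S" "v \<in> S" "w \<in> S" "u + v = w"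
  shows "c u = c v \<or> c u = c w \<or> c v = c w"
  using free[of u v w] assms unfolding rainbow_solution_def by blast

lemma lone_eqD: "lone p \<Longrightarrow> q \<in> S \<Longrightarrow> c q = c p \<Longrightarrow> diag q = diag p"
  unfolding lone_def by blast

lemma loneD: "lone p \<Longrightarrow> p \<in> S" "lone p \<Longrightarrow> diag p \<noteq> 0"
  unfolding lone_def by blast+

lemma lone_shift:
  assumes "lone (x, y)" "(x - s, y - s) \<in> S" "s \<in> {1..int m}"
  shows "c (x - s, y - s) = c (x, y) \<or> c (x - s, y - s) = c (s, s)"
proof -
  have "c (s, s) \<noteq> c (x, y)"
    using lone_eqD[OF assms(1), of "(s, s)"] diag_in_S[OF assms(3)] loneD(2)[OF assms(1)] by auto
  then show ?thesis
    using not_rainbow[of "(x - s, y - s)" "(s, s)" "(x, y)"] diag_in_S[OF assms(3)]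
      assms(2) loneD(1)[OF assms(1)] by auto
qed

text \<open>Otherwise the difference of the two points is in the grid, on a diagonal of the opposite
  sign. The three points of the sum then lie on three diagonals and two of them are lone, so the sum
  is rainbow.\<close>

lemma lone_mono:
  assumes "lone (x, y)" "lone (x', y')" "0 < x - y" "x - y < x' - y'"
  shows "x \<le> x'"
proof (rule ccontr)
  assume "\<not> x \<le> x'"
  then have S: "(x', y') \<in> S" "(x - x', y - y') \<in> S" "(x, y) \<in> S"
    using assms(3,4) loneD(1)[OF assms(1)] loneD(1)[OF assms(2)] by auto
  have "c (x', y') = c (x - x', y - y') \<or> c (x', y') = c (x, y) \<or> c (x - x', y - y') = c (x, y)"
    by (rule not_rainbow) (use S in auto)
  then show False
    using lone_eqD[OF assms(2), of "(x - x', y - y')"] lone_eqD[OF assms(1), of "(x', y')"]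
      lone_eqD[OF assms(1), of "(x - x', y - y')"] S assms(3,4) by auto
qed

text \<open>The mirror image of \<open>lone_mono\<close> on the other side of the main
  diagonal.\<close>

lemma lone_mono':
  assumes "lone (x, y)" "lone (x', y')" "0 < y - x" "y - x < y' - x'"
  shows "y \<le> y'"
proof (rule ccontr)
  assume "\<not> y \<le> y'"
  then have S: "(x', y') \<in> S" "(x - x', y - y') \<in> S" "(x, y) \<in> S"
    using assms(3,4) loneD(1)[OF assms(1)] loneD(1)[OF assms(2)] by auto
  have "c (x', y') = c (x - x', y - y') \<or> c (x', y') = c (x, y) \<or> c (x - x', y - y') = c (x, y)"
    by (rule not_rainbow) (use S in auto)
  then show False
    using lone_eqD[OF assms(2), of "(x - x', y - y')"] lone_eqD[OF assms(1), of "(x', y')"]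
      lone_eqD[OF assms(1), of "(x - x', y - y')"] S assms(3,4) by auto
qed

section \<open>First occurrences of colors on the main diagonal\<close>

definition first :: "int \<Rightarrow> bool" where
  "first a \<longleftrightarrow> a \<in> {1..int m} \<and> (\<forall>s\<in>{1..<a}. c (s, s) \<noteq> c (a, a))"

text \<open>The position a' - a comes before a', so it cannot have the color of a'. Hence it has the
  color of a, and a is the earliest such position.\<close>

lemma first_double:
  assumes "first a" "first a'" "a < a'"
  shows "2 * a \<le> a'"
proof -
  have "c (a, a) \<noteq> c (a', a')" "c (a' - a, a' - a) \<noteq> c (a', a')"
    using assms by (auto simp: first_def)
  then have eq: "c (a' - a, a' - a) = c (a, a)"
    using not_rainbow[of "(a, a)" "(a' - a, a' - a)" "(a', a')"] assms le by (auto simp: first_def)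
  have "\<not> a' - a < a"
    using assms(1,3) eq unfolding first_def by auto
  then show ?thesis by simp
qed

text \<open>Write v = (x, y) and z = (x', y'). The point (h, h) - v lies on the diagonal of z and must
  share the color of (h, h), which forces z to lie at least h steps away from it. As z is in the
  grid, it then lies strictly above v.\<close>

lemma lone_not_below_first:
  assumes v: "lone (x, y)" and z: "lone (x', y')" and opp: "x' - y' = y - x" and h: "first h"
  shows "h \<le> x \<or> h \<le> y"
proof (rule ccontr)
  assume "\<not> ?thesis"
  then have lt: "x < h" "y < h" by auto
  have nz: "x \<noteq> y" using loneD(2)[OF v] by simp
  have hS: "(h, h) \<in> S" "h \<in> {1..int m}" using h le by (auto simp: first_def)
  have vS: "(x, y) \<in> S" "(x', y') \<in> S" using loneD(1)[OF v] loneD(1)[OF z] by simp_all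
  have uS: "(h - x, h - y) \<in> S" using hS vS lt by auto
  have "c (h, h) \<noteq> c (x, y)" "c (h - x, h - y) \<noteq> c (x, y)"
    using lone_eqD[OF v, of "(h, h)"] lone_eqD[OF v, of "(h - x, h - y)"] hS uS nz by auto
  then have u: "c (h - x, h - y) = c (h, h)"
    using not_rainbow[of "(x, y)" "(h - x, h - y)" "(h, h)"] vS uS hS by auto
  have hz: "c (h, h) \<noteq> c (x', y')"
    using lone_eqD[OF z, of "(h, h)"] hS nz opp by auto
  define s where "s = x' - (h - x)"
  have s: "x' = h - x + s" "y' = h - y + s" using opp by (auto simp: s_def)
  have far: "h \<le> t" if "t \<in> {1..int m}" "c (t, t) = c (h, h)" for t
    using h that by (auto simp: first_def not_less[symmetric])
  consider "s = 0" | "0 < s" | "s < 0" by linarith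
  then show False
  proof cases
    case 1
    then show ?thesis using s u hz by auto
  next
    case 2
    then have sm: "s \<in> {1..int m}" using s vS uS by auto
    have "c (s, s) \<noteq> c (x', y')"
      using lone_eqD[OF z, of "(s, s)"] diag_in_S[OF sm] nz opp by auto
    moreover have "(h - x, h - y) + (s, s) = (x', y')" using s by simp
    ultimately have "c (s, s) = c (h, h)"
      using not_rainbow[OF uS diag_in_S[OF sm] vS(2)] u hz by metis
    then have "h \<le> s" using far sm by blast
    then have dS: "(x' - x, y' - y) \<in> S" using s lt vS by auto
    \<comment> \<open>The difference lies on diagonal 2 (y - x), so again three diagonals occur and
      two of the points are lone.\<close>
    have "c (x, y) = c (x' - x, y' - y) \<or> c (x, y) = c (x', y') \<or> c (x' - x, y' - y) = c (x', y')"
      by (rule not_rainbow) (use vS dS in auto)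
    then show ?thesis
      using lone_eqD[OF v, of "(x' - x, y' - y)"] lone_eqD[OF z, of "(x, y)"]
        lone_eqD[OF z, of "(x' - x, y' - y)"] vS dS opp nz by auto
  next
    case 3
    then have sm: "- s \<in> {1..int m}" using s vS uS by auto
    have "c (- s, - s) \<noteq> c (x', y')"
      using lone_eqD[OF z, of "(- s, - s)"] diag_in_S[OF sm] nz opp by auto
    moreover have "(x', y') + (- s, - s) = (h - x, h - y)" using s by simp
    ultimately have "c (- s, - s) = c (h, h)"
      using not_rainbow[OF vS(2) diag_in_S[OF sm] uS] u hz by metis
    then have "h \<le> - s" using far sm by blast
    then show ?thesis using s vS by auto
  qed
qed

section \<open>Counting colors against diagonals\<close>

text \<open>This makes the sets of diagonals met by different new colors disjoint.\<close>

lemma new_unique: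
  assumes "p \<in> S" "q \<in> S" "diag p = diag q" "c p \<notin> old" "c q \<notin> old"
  shows "c p = c q"
proof -
  have *: "c p = c q"
    if "p \<in> S" "q \<in> S" "diag p = diag q" "c p \<notin> old" "c q \<notin> old" "fst p < fst q" for p q
  proof -
    obtain x y where p: "p = (x, y)" by (cases p)
    obtain x' y' where q: "q = (x', y')" by (cases q)
    define s where "s = x' - x"
    have s: "s \<in> {1..int m}" "y' = y + s" "x' = x + s" using that p q by (auto simp: s_def)
    have "c (s, s) \<in> old" using s(1) by (auto simp: old_def)
    then show ?thesis
      using not_rainbow[of p "(s, s)" q] that s p q diag_in_S[OF s(1)] by auto
  qed
  consider "fst p < fst q" | "fst q < fst p" | "p = q"
    using assms(3) by (cases p; cases q) (force simp: diag_def)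
  then show ?thesis using *[of p q] *[of q p] assms by cases auto
qed

lemma diag_range:
  assumes "p \<in> S" shows "diag p \<in> {1 - int n..int m - 1}"
  using assms by (cases p) auto

text \<open>The new colors, m + n + 1 - \<open>card old\<close> in number, occupy disjoint nonempty
  sets among the m + n - 2 other diagonals. A color occupying just one makes that diagonal good, so
  few bad diagonals are possible.\<close>

lemma card_bad_le:
  assumes surj: "c ` S = {1..m + n + 1}"
  shows "3 \<le> card old" "card bad + 6 \<le> 2 * card old"
proof -
  let ?D = "{1 - int n..int m - 1} - {0}"
  let ?N = "c ` S - old"
  define A where "A \<chi> = {d \<in> ?D. \<exists>p\<in>S. diag p = d \<and> c p = \<chi>}" for \<chi>
  have old_sub: "old \<subseteq> c ` S" using diag_in_S by (auto simp: old_def)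
  then have cN: "card ?N + card old = m + n + 1"
    using surj card_mono[OF finite_imageI[OF finite_S] old_sub] finite_subset[OF old_sub]
    by (simp add: card_Diff_subset)
  have finN: "finite ?N" using finite_S by simp
  have finA: "finite (A \<chi>)" for \<chi> by (rule finite_subset[of _ ?D]) (auto simp: A_def)
  have diag0: "c p \<in> old" if "p \<in> S" "diag p = 0" for p
    using that by (cases p) (auto simp: old_def)
  have cD: "card ?D + 2 = m + n" using pos le by (simp add: card_Diff_subset)
  have A_ne: "1 \<le> card (A \<chi>)" if "\<chi> \<in> ?N" for \<chi>
  proof -
    obtain p where p: "p \<in> S" "c p = \<chi>" "c p \<notin> old" using \<open>\<chi> \<in> ?N\<close> by auto
    have "diag p \<in> A \<chi>" unfolding A_def using p diag0 diag_range by blast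
    then have "A \<chi> \<noteq> {}" by auto
    then show ?thesis using finA[of \<chi>] by (simp add: Suc_leI card_gt_0_iff)
  qed
  have disj: "\<chi> = \<chi>'" if "\<chi> \<in> ?N" "\<chi>' \<in> ?N" "d \<in> A \<chi>" "d \<in> A \<chi>'" for \<chi> \<chi>' d
  proof -
    obtain p q where "p \<in> S" "diag p = d" "c p = \<chi>" "q \<in> S" "diag q = d" "c q = \<chi>'"
      using \<open>d \<in> A \<chi>\<close> \<open>d \<in> A \<chi>'\<close> by (auto simp: A_def)
    then show ?thesis using new_unique[of p q] that(1,2) by simp
  qed
  have "(\<Sum>\<chi>\<in>?N. card (A \<chi>)) = card (\<Union>\<chi>\<in>?N. A \<chi>)"
    using finN finA disj by (intro card_UN_disjoint[symmetric]) auto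
  also have "\<dots> \<le> card ?D" by (intro card_mono) (auto simp: A_def)
  finally have sumA: "(\<Sum>\<chi>\<in>?N. card (A \<chi>)) \<le> card ?D" .
  let ?U = "{\<chi> \<in> ?N. card (A \<chi>) = 1}"
  let ?G = "{d \<in> ?D. good d}"
  have finG: "finite ?G" by (rule finite_subset[of _ ?D]) auto
  have "card ?U \<le> card ?G"
  proof (rule card_inj_on_le)
    have single: "the_elem (A \<chi>) \<in> A \<chi>" "\<And>d. d \<in> A \<chi> \<Longrightarrow> d = the_elem (A \<chi>)"
      if "\<chi> \<in> ?U" for \<chi>
    proof -
      have "card (A \<chi>) = 1" using that by blast
      then obtain a where "A \<chi> = {a}" by (rule card_1_singletonE)
      then show "the_elem (A \<chi>) \<in> A \<chi>" "\<And>d. d \<in> A \<chi> \<Longrightarrow> d = the_elem (A \<chi>)"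
        by simp_all
    qed
    show "inj_on (\<lambda>\<chi>. the_elem (A \<chi>)) ?U"
    proof (rule inj_onI)
      fix \<chi> \<chi>' assume *: "\<chi> \<in> ?U" "\<chi>' \<in> ?U" "the_elem (A \<chi>) = the_elem (A \<chi>')"
      have "the_elem (A \<chi>) \<in> A \<chi>'" using single(1)[OF *(2)] *(3) by simp
      then show "\<chi> = \<chi>'" using disj single(1)[OF *(1)] * by blast
    qed
    show "(\<lambda>\<chi>. the_elem (A \<chi>)) ` ?U \<subseteq> ?G"
    proof (rule image_subsetI)
      fix \<chi> assume \<chi>: "\<chi> \<in> ?U"
      let ?d = "the_elem (A \<chi>)"
      obtain p where p: "p \<in> S" "diag p = ?d" "c p = \<chi>" "?d \<in> ?D"
        using single(1)[OF \<chi>] unfolding A_def by blast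
      have "diag q = ?d" if q: "q \<in> S" "c q = \<chi>" for q
      proof -
        have "diag q \<noteq> 0" using diag0 q \<chi> by blast
        then have "diag q \<in> A \<chi>" unfolding A_def using q diag_range by blast
        then show ?thesis by (rule single(2)[OF \<chi>])
      qed
      then have "lone p" unfolding lone_def using p by auto
      then show "?d \<in> ?G" using p unfolding good_def by blast
    qed
    show "finite ?G" by (rule finG)
  qed
  \<comment> \<open>A color on a single diagonal contributes 1 + 1 to the right side, any other
    color at least 2.\<close>
  moreover have "2 * card ?N \<le> (\<Sum>\<chi>\<in>?N. card (A \<chi>)) + card ?U"
  proof -
    have "2 * card ?N = (\<Sum>\<chi>\<in>?N. 2)" by simp
    also have "\<dots> \<le> (\<Sum>\<chi>\<in>?N. card (A \<chi>) + (if card (A \<chi>) = 1 then 1 else 0))"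
    proof (rule sum_mono)
      fix \<chi> assume "\<chi> \<in> ?N"
      then show "2 \<le> card (A \<chi>) + (if card (A \<chi>) = 1 then 1 else 0)" using A_ne[of \<chi>] by auto
    qed
    also have "\<dots> = (\<Sum>\<chi>\<in>?N. card (A \<chi>)) + card ?U"
      using finN by (simp add: sum.distrib sum.If_cases Int_def)
    finally show ?thesis .
  qed
  moreover have "card ?G + card bad = card ?D"
  proof -
    have "?D = ?G \<union> bad" "?G \<inter> bad = {}" by (auto simp: bad_def)
    then show ?thesis using card_Un_disjoint[OF finG finite_bad] by metis
  qed
  ultimately show "card bad + 6 \<le> 2 * card old" using cN cD sumA by linarith
  have "card ?N = (\<Sum>\<chi>\<in>?N. 1)" by simp
  also have "\<dots> \<le> (\<Sum>\<chi>\<in>?N. card (A \<chi>))" using A_ne by (intro sum_mono) auto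
  finally show "3 \<le> card old" using cN cD sumA by linarith
qed

text \<open>Doubling makes the gap between \<open>b\<close> and \<open>h\<close> exponential in
  \<open>k\<close>. The linear bound kept here is what the two descents consume when there are at
  most 2 k bad diagonals.\<close>

lemma exists_first_pair:
  assumes "card old = k + 3"
  obtains b h where "first b" "first h" "2 \<le> b" "b + 4 * int k + 2 \<le> h"
proof -
  let ?P = "{a. first a}"
  have finP: "finite ?P" by (rule finite_subset[of _ "{1..int m}"]) (auto simp: first_def)
  have "\<exists>a'. first a' \<and> c (a', a') = c (a, a)" if a: "a \<in> {1..int m}" for a
  proof -
    let ?Q = "{s \<in> {1..int m}. c (s, s) = c (a, a)}"
    have fin: "finite ?Q" by (rule finite_subset[of _ "{1..int m}"]) auto
    have Q: "Min ?Q \<in> ?Q" using a fin by (intro Min_in) auto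
    have "first (Min ?Q)"
      unfolding first_def
    proof (intro conjI ballI notI)
      show "Min ?Q \<in> {1..int m}" using Q by blast
      fix s assume s: "s \<in> {1..<Min ?Q}" "c (s, s) = c (Min ?Q, Min ?Q)"
      then have "s \<in> ?Q" using Q by auto
      then have "Min ?Q \<le> s" using fin by simp
      then show False using s by simp
    qed
    then show ?thesis using Q by blast
  qed
  then have "old \<subseteq> (\<lambda>a. c (a, a)) ` ?P" unfolding old_def by (force simp: image_iff)
  then have "k + 3 \<le> card ?P"
    using card_mono[OF finite_imageI[OF finP]] card_image_le[OF finP] assms by (metis le_trans)
  \<comment> \<open>Position 1 is discarded so that \<open>b - 1\<close> is still a position on the
    main diagonal.\<close>
  then have "k + 2 \<le> card (?P - {1})" by (cases "1 \<in> ?P") (auto simp: card_Diff_singleton)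
  then obtain Q where Q: "Q \<subseteq> ?P - {1}" "card Q = Suc (k + 1)" "finite Q"
    using obtain_subset_with_card_n by (metis add_2_eq_Suc' add_Suc_right Suc_eq_plus1)
  have ne: "Q \<noteq> {}" using Q(2) by auto
  have "2 ^ (k + 1) * Min Q \<le> Max Q"
  proof (rule Max_ge_power_Min[OF Q(3,2)])
    show "0 < a" if "a \<in> Q" for a using that Q(1) by (auto simp: first_def)
    show "2 * a \<le> a'" if "a \<in> Q" "a' \<in> Q" "a < a'" for a a'
      using that Q(1) first_double by blast
  qed
  moreover have min: "first (Min Q)" and max: "first (Max Q)" and "Min Q \<noteq> 1"
    using Min_in[OF Q(3) ne] Max_in[OF Q(3) ne] Q(1) by auto
  then have two: "2 \<le> Min Q" by (auto simp: first_def)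
  moreover have "Min Q + 4 * int k + 2 \<le> 2 ^ (k + 1) * Min Q"
  proof -
    have "int (4 * k + 4) \<le> int (2 ^ (k + 2))" using four_mult_le_power[of k] by (simp only: of_nat_le_iff)
    then have "4 * int k + 2 \<le> (2 ^ (k + 1) - 1) * 2" by (simp add: algebra_simps)
    also have "\<dots> \<le> (2 ^ (k + 1) - 1) * Min Q" using two by (intro mult_left_mono) auto
    finally show ?thesis by (simp add: algebra_simps)
  qed
  ultimately show ?thesis using that[OF min max] by linarith
qed

section \<open>The staircase and the final contradiction\<close>

text \<open>The monotonicity lemmas hold for all lone points, so an arbitrary choice on each good
  diagonal gives the staircase.\<close>

definition z :: "int \<Rightarrow> int \<times> int" where
  "z d = (SOME p. lone p \<and> diag p = d)"

lemma z_props: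
  assumes "good d"
  shows "lone (z d)" "fst (z d) - snd (z d) = d"
proof -
  have "lone (z d) \<and> diag (z d) = d"
    unfolding z_def by (rule someI_ex) (use assms in \<open>simp add: good_def\<close>)
  then show "lone (z d)" "fst (z d) - snd (z d) = d" by (simp_all add: diag_def)
qed

lemma lone_z: "good d \<Longrightarrow> lone (fst (z d), snd (z d))"
  using z_props(1) by simp

lemma z_in_S:
  assumes "good d"
  shows "1 \<le> fst (z d)" "fst (z d) \<le> int m" "1 \<le> snd (z d)" "snd (z d) \<le> int n"
  using loneD(1)[OF lone_z[OF assms]] unfolding in_S by blast+

lemma first_color_neq: "first b \<Longrightarrow> 2 \<le> b \<Longrightarrow> c (b - 1, b - 1) \<noteq> c (b, b)"
  by (simp add: first_def)

lemma not_surj: "c ` S \<noteq> {1..m + n + 1}"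
proof
  assume surj: "c ` S = {1..m + n + 1}"
  obtain k where k: "card old = k + 3"
    using card_bad_le(1)[OF surj] by (metis add.commute le_Suc_ex)
  have cbad: "card bad \<le> 2 * k" using card_bad_le(2)[OF surj] k by simp
  obtain b h where b: "first b" "2 \<le> b" and h: "first h" and hb: "b + 4 * int k + 2 \<le> h"
    using exists_first_pair[OF k] by metis
  have bm: "b \<le> int m" "h \<le> int m" using b h by (auto simp: first_def)
  let ?good2 = "\<lambda>i. good (int i) \<and> good (- int i)"
  define inner where "inner i = bad \<inter> {- int i<..<int i}" for i :: nat
  have inner: "i \<le> card (inner (Suc i))"
    if "\<And>j. 1 \<le> j \<Longrightarrow> j \<le> i \<Longrightarrow> \<not> ?good2 j" "i < m" for i
  proof -
    \<comment> \<open>\<open>w j\<close> picks a bad diagonal from the pair j, -j.\<close>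
    define w where "w j = (if good (int j) then - int j else int j)" for j
    have "inj_on w {1..i}" by (auto simp: inj_on_def w_def split: if_splits)
    moreover have "w ` {1..i} \<subseteq> inner (Suc i)"
      using that le by (auto simp: w_def inner_def bad_def)
    ultimately have "card {1..i} \<le> card (inner (Suc i))"
      using finite_bad by (intro card_inj_on_le[of w]) (auto simp: inner_def)
    then show ?thesis by simp
  qed
  let ?start = "\<lambda>i. 1 \<le> i \<and> i < m \<and> ?good2 i"
  have ex: "\<exists>i. ?start i"
  proof (rule ccontr)
    assume "\<not> ?thesis"
    \<comment> \<open>Otherwise m - 1 <= 2 k, whereas m >= h >= b + 4 k + 2.\<close>
    then have "m - 1 \<le> card (inner (Suc (m - 1)))" using pos by (intro inner) auto
    also have "\<dots> \<le> card bad" using finite_bad by (intro card_mono) (auto simp: inner_def)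
    finally show False using cbad hb bm b by linarith
  qed
  \<comment> \<open>The least pair of opposite good diagonals is where both descents start. The i0 -
    1 pairs before it each use up a bad diagonal, which tightens the count farther out.\<close>
  define i0 where "i0 = (LEAST i. ?start i)"
  have i0: "1 \<le> i0" "i0 < m" "?good2 i0" using LeastI_ex[OF ex] by (auto simp: i0_def)
  have least: "\<not> ?good2 j" if "1 \<le> j" "j < i0" for j
    using not_less_Least[OF that(2)[unfolded i0_def]] that i0 by auto
  have used: "i0 - 1 \<le> card (inner i0)" using inner[of "i0 - 1"] i0 least by auto
  have outer: "int (card X) \<le> 2 * int k + 1 - int i0" if "X \<subseteq> bad" "X \<inter> inner i0 = {}" for X
  proof -
    have "card X + card (inner i0) = card (X \<union> inner i0)"
      using that finite_bad by (intro card_Un_disjoint[symmetric]) (auto simp: inner_def finite_subset)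
    also have "\<dots> \<le> card bad" using that finite_bad by (intro card_mono) (auto simp: inner_def)
    finally show ?thesis using used cbad i0 by linarith
  qed
  define d0 where "d0 = int i0"
  have d0: "1 \<le> d0" "d0 \<le> int m - 1" "good d0" "good (- d0)" using i0 by (auto simp: d0_def)
  \<comment> \<open>Of the two coordinates the larger one reaches \<open>h\<close>: the first on a
    positive diagonal, the second on a negative one.\<close>
  have start: "h \<le> fst (z d0)" "h \<le> snd (z (- d0))"
    using lone_not_below_first[OF lone_z[OF d0(3)] lone_z[OF d0(4)] _ h]
      lone_not_below_first[OF lone_z[OF d0(4)] lone_z[OF d0(3)] _ h]
      z_props(2)[OF d0(3)] z_props(2)[OF d0(4)] d0(1) by auto
  have "\<exists>d. d0 \<le> d \<and> d < int m - 1 \<and> d \<in> Collect good \<and> d + 1 \<in> Collect good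
      \<and> b < snd (z d) \<and> snd (z (d + 1)) = snd (z d) - 1"
  proof (rule exists_unit_descent)
    \<comment> \<open>At most 2 k + 1 - d0 diagonals are missing, and the height at
      \<open>d0\<close> is at least h - d0 >= b + 4 k + 2 - d0. As d0 >= 1, this suffices.\<close>
    show "b + 2 * int (card ({d0..int m - 1} - Collect good)) < snd (z d0)"
      using outer[of "{d0..int m - 1} - Collect good"] start z_props(2)[OF d0(3)] hb d0
      by (force simp: bad_def inner_def d0_def)
    show "snd (z d) - (e - d) \<le> snd (z e)"
      if "d \<in> Collect good" "e \<in> Collect good" "d0 \<le> d" "d < e" for d e
      using lone_mono[OF lone_z[of d] lone_z[of e]] z_props(2)[of d] z_props(2)[of e] that d0 by auto
    show "snd (z d) \<le> int m - 1 + 1 - d" if "d \<in> Collect good" for d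
      using that z_props(2)[of d] z_in_S(2)[of d] by simp
  qed (use d0 b in auto)
  then obtain d where d: "d0 \<le> d" "good d" "good (d + 1)" "b < snd (z d)"
    "snd (z (d + 1)) = snd (z d) - 1" by auto
  have "\<exists>e. d0 \<le> e \<and> e < int n - 1 \<and> e \<in> {e. good (- e)} \<and> e + 1 \<in> {e. good (- e)}
      \<and> b < fst (z (- e)) \<and> fst (z (- (e + 1))) = fst (z (- e)) - 1"
  proof (rule exists_unit_descent)
    \<comment> \<open>Negation turns the missing indices into bad diagonals, so that
      \<open>outer\<close> applies.\<close>
    have "card ({d0..int n - 1} - {e. good (- e)}) = card (uminus ` ({d0..int n - 1} - {e. good (- e)}))"
      by (simp add: card_image)
    then show "b + 2 * int (card ({d0..int n - 1} - {e. good (- e)})) < fst (z (- d0))"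
      using outer[of "uminus ` ({d0..int n - 1} - {e. good (- e)})"] start z_props(2)[OF d0(4)] hb d0
      by (force simp: bad_def inner_def d0_def)
    show "fst (z (- d)) - (e - d) \<le> fst (z (- e))"
      if "d \<in> {e. good (- e)}" "e \<in> {e. good (- e)}" "d0 \<le> d" "d < e" for d e
      using lone_mono'[OF lone_z[of "- d"] lone_z[of "- e"]] z_props(2)[of "- d"] z_props(2)[of "- e"]
        that d0 by auto
    show "fst (z (- d)) \<le> int n - 1 + 1 - d" if "d \<in> {e. good (- e)}" for d
      using that z_props(2)[of "- d"] z_in_S(4)[of "- d"] by simp
  qed (use d0 b le in auto)
  then obtain e where e: "d0 \<le> e" "good (- e)" "good (- (e + 1))" "b < fst (z (- e))"
    "fst (z (- (e + 1))) = fst (z (- e)) - 1" by auto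
  \<comment> \<open>Both descents are tested against this point: \<open>?w\<close> plus a translate
    of one staircase point along its diagonal is the neighbouring staircase point.\<close>
  let ?w = "(b, b - 1)"
  have wS: "?w \<in> S" using b bm le by auto
  obtain x y where zd: "z d = (x, y)" by (cases "z d")
  have x: "x = y + d" using z_props(2)[OF d(2)] zd by simp
  have zd1: "z (d + 1) = (x, y - 1)"
    using z_props(2)[OF d(3)] d(5) zd x by (cases "z (d + 1)") auto
  have L: "lone (x, y)" "lone (x, y - 1)" using z_props(1) d zd zd1 by metis+
  have uS: "(x - b, y - b) \<in> S" using loneD(1)[OF L(1)] d(4) zd x b d(1) d0 by auto
  have "c (x - b, y - b) \<noteq> c (x, y - 1)" "c ?w \<noteq> c (x, y - 1)"
    using lone_eqD[OF L(2), of "(x - b, y - b)"] lone_eqD[OF L(2), of ?w] uS wS x d(1) d0(1) by auto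
  then have wu: "c ?w = c (x - b, y - b)"
    using not_rainbow[of "(x - b, y - b)" ?w "(x, y - 1)"] uS wS loneD(1)[OF L(2)] by auto
  \<comment> \<open>The only alternative is that \<open>?w\<close> has the color of (x, y). Then d =
    1 and \<open>?w\<close> itself is lone, but it lies too low opposite the lone point on diagonal
    -1.\<close>
  have wB: "c ?w = c (b, b)"
  proof (rule ccontr)
    assume neq: "c ?w \<noteq> c (b, b)"
    then have eq: "c ?w = c (x, y)" using lone_shift[OF L(1) uS] wu b bm by auto
    then have "d = 1" using lone_eqD[OF L(1) wS] x by simp
    then have "d0 = 1" using d0 d by simp
    have "lone ?w" using L(1) eq wS x \<open>d = 1\<close> unfolding lone_def by auto
    then have "h \<le> b"
      using lone_not_below_first[OF _ lone_z[OF d0(4)] _ h, of b "b - 1"] z_props(2)[OF d0(4)] \<open>d0 = 1\<close>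
      by auto
    then show False using hb by simp
  qed
  obtain x' y' where ze: "z (- (e + 1)) = (x', y')" by (cases "z (- (e + 1))")
  have y': "y' = x' + e + 1" using z_props(2)[OF e(3)] ze by simp
  have ze1: "z (- e) = (x' + 1, y')"
    using z_props(2)[OF e(2)] e(5) ze y' by (cases "z (- e)") auto
  have L': "lone (x', y')" "lone (x' + 1, y')" using z_props(1) e ze ze1 by metis+
  \<comment> \<open>Here the shift is by \<open>b - 1\<close>. As \<open>?w\<close> lies on diagonal
    1 and these lone points on negative ones, no exceptional case arises.\<close>
  have tS: "(x' - (b - 1), y' - (b - 1)) \<in> S"
    using loneD(1)[OF L'(1)] e(4) ze1 y' b e(1) d0 by auto
  have "c (x' - (b - 1), y' - (b - 1)) \<noteq> c (x' + 1, y')" "c ?w \<noteq> c (x' + 1, y')" "c ?w \<noteq> c (x', y')"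
    using lone_eqD[OF L'(2), of "(x' - (b - 1), y' - (b - 1))"] lone_eqD[OF L'(2), of ?w]
      lone_eqD[OF L'(1), of ?w] tS wS y' e(1) d0(1) by auto
  moreover from this have "c ?w = c (x' - (b - 1), y' - (b - 1))"
    using not_rainbow[of "(x' - (b - 1), y' - (b - 1))" ?w "(x' + 1, y')"] tS wS
      loneD(1)[OF L'(2)] by auto
  ultimately have "c ?w = c (b - 1, b - 1)"
    using lone_shift[OF L'(1) tS] b bm by auto
  then show False using wB first_color_neq b by metis
qed

end

theorem theorem5p4:
  fixes m n :: nat and c :: "int \<times> int \<Rightarrow> nat"
  assumes "8 \<le> m" and "m \<le> n"
    and "exact_coloring (m + n + 1) (grid m n) c"
  shows "\<exists>\<alpha> \<beta> \<gamma>. rainbow_solution (grid m n) c \<alpha> \<beta> \<gamma>"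
proof (rule ccontr)
  assume "\<not> ?thesis"
  then interpret rainbow_free m n c by unfold_locales (use assms in auto)
  show False using not_surj assms(3) by (simp add: exact_coloring_def)
qed

end
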